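(* Let $G$ be a graph and let $\mathcal{C}$ be a set of nodes of $G$ that is a collar, a pendant, or a bracelet of size $r$. Then every $r$-th root of unity $\lambda$ (i.e. every $\lambda\in\mathbb{C}$ with $\lambda^r=1$) is an eigenvalue of the NB-matrix $B$ of $G$, with a corresponding eigenvector supported on $\mathcal{C}$.
   Context: Graphs are finite, simple, undirected, unweighted, connected, with at least $2$ nodes. Let $\bar E$ be the set of oriented edges of $G$ (each undirected edge $u-v$ gives the two oriented edges $u\to v$ and $v\to u$). The NB-matrix (non-backtracking matrix) $B$ of $G$ is the $2m\times 2m$ matrix ($m$ the number of edges) indexed by $\bar E$ with $B_{k\to l,\,i\to j}=\delta_{jk}(1-\delta_{il})$. Vectors are complex vectors indexed by $\bar E$; eigenvectors are nonzero right eigenvectors, $B\mathbf v=\lambda\mathbf v$. A vector $\mathbf v$ is supported on $\mathcal C$ here if $\mathbf v_{k\to l}=0$ unless both $k,l\in\mathcal C$. Pendant of size $r$: a set of $r$ nodes, $r$ odd, inducing a cycle, such that all its nodes have degree $2$ in $G$ except for exactly one node, which may have arbitrary degree. Collar of size $r$: a set of $r$ nodes, $r$ even, inducing a cycle, such that all its nodes have degree $2$ in $G$ except perhaps for two diametrically opposite nodes of the cycle, which may have arbitrary degrees; these two opposite nodes may or may not be adjacent to each other (if they are, the induced graph is the cycle together with this one extra edge). Bracelet of size $r$: a set of nodes inducing a "figure eight" graph made of two cycles of the same length $r/2$ joined at one node ($r$ even), such that all its nodes have degree $2$ in $G$ except perhaps for the node at which the two cycles meet, which may have arbitrary degree. (It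 is a degenerate collar of size $r$ in which the two opposite nodes have been identified.) *)

theory Defs
  imports "Jordan_Normal_Form.Char_Poly" "Graph_Theory.Graph_Theory"
begin

text \<open>
  A finite simple undirected graph is a \<^locale>\<open>pair_graph\<close>: a symmetric loop-free digraph whose arcs
  are ordered pairs of vertices. Its arcs are exactly the oriented edges \<open>k \<rightarrow> l\<close>, and
  \<^const>\<open>out_degree\<close> is the degree of a vertex.

  Matrices of the library are indexed by natural numbers, so the rows and columns of the
  NB-matrix are numbered by a list \<open>es\<close> enumerating the oriented edges without repetition.
  Row \<open>a\<close> belongs to \<open>es ! a = (k, l)\<close> and column \<open>b\<close> to \<open>es ! b = (i, j)\<close>.
\<close>

definition enumerates_arcs :: "('a \<times> 'a) list \<Rightarrow> 'a pair_pre_digraph \<Rightarrow> bool" where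
  "enumerates_arcs es G \<longleftrightarrow> distinct es \<and> set es = parcs G"

definition nb_entry :: "'a \<times> 'a \<Rightarrow> 'a \<times> 'a \<Rightarrow> complex" where
  "nb_entry = (\<lambda>(k, l) (i, j). of_bool (j = k) * (1 - of_bool (i = l)))"

definition nb_matrix :: "('a \<times> 'a) list \<Rightarrow> complex mat" where
  "nb_matrix es = mat (length es) (length es) (\<lambda>(a, b). nb_entry (es ! a) (es ! b))"

definition supported_on :: "('a \<times> 'a) list \<Rightarrow> complex vec \<Rightarrow> 'a set \<Rightarrow> bool" where
  "supported_on es v C \<longleftrightarrow>
     (\<forall>a < length es. \<not> (fst (es ! a) \<in> C \<and> snd (es ! a) \<in> C) \<longrightarrow> v $ a = 0)"

text \<open>
  \<open>f\<close> is an isomorphism from the graph on \<open>{0, \<dots>, n - 1}\<close> with adjacency relation \<open>R\<close> onto the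
  subgraph of \<open>G\<close> induced by \<open>C\<close>.
\<close>

definition induced_iso ::
  "'a pair_pre_digraph \<Rightarrow> nat \<Rightarrow> (nat \<Rightarrow> nat \<Rightarrow> bool) \<Rightarrow> (nat \<Rightarrow> 'a) \<Rightarrow> 'a set \<Rightarrow> bool" where
  "induced_iso G n R f C \<longleftrightarrow>
     C \<subseteq> pverts G \<and> bij_betw f {..<n} C \<and> (\<forall>i<n. \<forall>j<n. (f i, f j) \<in> parcs G \<longleftrightarrow> R i j)"

definition cycle_adj :: "nat \<Rightarrow> nat \<Rightarrow> nat \<Rightarrow> bool" where
  "cycle_adj n i j \<longleftrightarrow> j = Suc i mod n \<or> i = Suc j mod n"

definition chorded_cycle_adj :: "nat \<Rightarrow> nat \<Rightarrow> nat \<Rightarrow> bool" where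
  "chorded_cycle_adj n i j \<longleftrightarrow> cycle_adj n i j \<or> {i, j} = {0, n div 2}"

definition induces_cycle :: "'a pair_pre_digraph \<Rightarrow> 'a set \<Rightarrow> nat \<Rightarrow> bool" where
  "induces_cycle G C n \<longleftrightarrow> n \<ge> 3 \<and> (\<exists>f. induced_iso G n (cycle_adj n) f C)"

text \<open>The exceptional vertices below may have any degree, including degree 2.\<close>

definition pendant :: "'a pair_pre_digraph \<Rightarrow> 'a set \<Rightarrow> nat \<Rightarrow> bool" where
  "pendant G C r \<longleftrightarrow> odd r \<and> induces_cycle G C r \<and>
     (\<exists>w\<in>C. \<forall>v\<in>C - {w}. out_degree G v = 2)"

text \<open>
  The labelling \<open>f\<close> of the cycle is chosen to start at one of the two exceptional vertices, so
  that they are \<open>f 0\<close> and \<open>f (r div 2)\<close>.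
\<close>

definition collar :: "'a pair_pre_digraph \<Rightarrow> 'a set \<Rightarrow> nat \<Rightarrow> bool" where
  "collar G C r \<longleftrightarrow> even r \<and> r \<ge> 3 \<and>
     (\<exists>f. (induced_iso G r (cycle_adj r) f C \<or> induced_iso G r (chorded_cycle_adj r) f C) \<and>
          (\<forall>v\<in>C - {f 0, f (r div 2)}. out_degree G v = 2))"

text \<open>
  The figure eight on \<open>C\<close> consists of the cycles induced by \<open>A\<close> and \<open>A'\<close>, which share exactly
  the vertex \<open>w\<close>; it has \<open>r - 1\<close> vertices and \<open>r\<close> edges.
\<close>

definition bracelet :: "'a pair_pre_digraph \<Rightarrow> 'a set \<Rightarrow> nat \<Rightarrow> bool" where
  "bracelet G C r \<longleftrightarrow> even r \<and>
     (\<exists>A A' w. C = A \<union> A' \<and> A \<inter> A' = {w} \<and>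
        induces_cycle G A (r div 2) \<and> induces_cycle G A' (r div 2) \<and>
        (\<forall>x\<in>A - {w}. \<forall>y\<in>A' - {w}. (x, y) \<notin> parcs G) \<and>
        (\<forall>v\<in>C - {w}. out_degree G v = 2))"

end

theory Submission
  imports Defs
begin

text \<open>
  View a vector over the oriented edges as a function \<open>x\<close> on arcs. Since the graph is symmetric,
  row \<open>k \<rightarrow> l\<close> of the NB-matrix maps \<open>x\<close> to the total of \<open>x\<close> over all arcs into \<open>k\<close>, minus
  \<open>x (l, k)\<close>. So \<open>x\<close> is an eigenvector for \<open>z\<close> iff it is nonzero and, at every arc \<open>(k, l)\<close>, the
  expression \<open>z * x (k, l) + x (l, k)\<close> equals the inflow at \<open>k\<close>; in particular it depends on \<open>k\<close>
  alone. The difference of the two sides, \<open>defect\<close>, is linear in \<open>x\<close>.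

  Around a cycle \<open>f 0, \<dots>, f (n - 1)\<close> send a wave in each direction: put \<open>z\<^sup>-\<^sup>i\<close> on the arc from \<open>f i\<close>
  to its successor and \<open>- z\<^sup>i\<^sup>+\<^sup>1\<close> on the reverse arc. If \<open>z\<^sup>n = 1\<close>, both sides of the equation at
  \<open>f m\<close> are equal to \<open>z\<^sup>1\<^sup>-\<^sup>m - z\<^sup>1\<^sup>+\<^sup>m\<close> along the two cycle arcs leaving \<open>f m\<close>. On any other arc leaving
  \<open>f m\<close> the left side is \<open>0\<close>, so such arcs are harmless precisely when \<open>z\<^sup>2\<^sup>m = 1\<close>. This holds for
  \<open>m = 0\<close>, and for \<open>m = n / 2\<close> when \<open>n\<close> is even: exactly the exceptional vertices of a pendant and
  of a collar. A chord between the two exceptional vertices is one more such harmless arc.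

  For a bracelet only \<open>z\<^sup>2\<^sup>n = 1\<close> is known, where \<open>n\<close> is the length of each of the two cycles. Then
  the equation can fail, but only at arcs leaving \<open>f 0\<close>, and by an amount \<open>z * (1 - z\<^sup>n)\<close> that is
  the same for all these arcs and does not depend on the cycle (\<open>defect_cycle_vec\<close>). Hence the
  difference of the waves on the two cycles, both started at the common vertex, is an eigenvector.
\<close>

section \<open>The eigenvalue equation on arcs\<close>

definition inflow :: "'a pair_pre_digraph \<Rightarrow> ('a \<times> 'a \<Rightarrow> complex) \<Rightarrow> 'a \<Rightarrow> complex" where
  "inflow G x k = (\<Sum>e\<in>{e \<in> parcs G. snd e = k}. x e)"

definition defect ::
  "'a pair_pre_digraph \<Rightarrow> complex \<Rightarrow> ('a \<times> 'a \<Rightarrow> complex) \<Rightarrow> 'a \<Rightarrow> 'a \<Rightarrow> complex" where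
  "defect G z x k l = z * x (k, l) + x (l, k) - inflow G x k"

text \<open>
  The entry excludes backtracking by the arc \<open>(l, k)\<close> only, which is one of the arcs into \<open>k\<close> as
  soon as the graph is symmetric.
\<close>

lemma nb_row:
  assumes sym: "(l, k) \<in> E" and fin: "finite E"
  shows "(\<Sum>e\<in>E. nb_entry (k, l) e * x e) = (\<Sum>e\<in>{e \<in> E. snd e = k}. x e) - x (l, k)"
proof -
  have "(\<Sum>e\<in>E. nb_entry (k, l) e * x e)
      = (\<Sum>e\<in>E. (if snd e = k then x e else 0) - (if e = (l, k) then x e else 0))"
    by (rule sum.cong) (auto simp: nb_entry_def split: prod.splits)
  also have "\<dots> = (\<Sum>e\<in>{e \<in> E. snd e = k}. x e) - x (l, k)"
    using assms by (simp add: sum_subtractf sum.inter_filter[symmetric] sum.delta)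
  finally show ?thesis .
qed

lemma eigenvector_of_zero_defect:
  assumes G: "pair_graph G" and es: "enumerates_arcs es G"
    and zero: "\<And>k l. (k, l) \<in> parcs G \<Longrightarrow> defect G z x k l = 0"
    and supp: "\<And>k l. \<not> (k \<in> C \<and> l \<in> C) \<Longrightarrow> x (k, l) = 0"
    and nz: "e0 \<in> parcs G" "x e0 \<noteq> 0"
  shows "eigenvalue (nb_matrix es) z \<and>
    (\<exists>v. eigenvector (nb_matrix es) v z \<and> supported_on es v C)"
proof -
  interpret pair_graph G by (rule G)
  define v where "v = vec (length es) (\<lambda>a. x (es ! a))"
  have dist: "distinct es" and set: "set es = parcs G"
    using es by (auto simp: enumerates_arcs_def)
  have over_arcs: "(\<Sum>b<length es. h (es ! b)) = (\<Sum>e\<in>parcs G. h e)"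
    for h :: "'a \<times> 'a \<Rightarrow> complex"
    using sum.reindex_bij_betw[OF bij_betw_nth[OF dist refl set[symmetric]], of h] by simp
  have row: "(nb_matrix es *\<^sub>v v) $ a = z * x (es ! a)" if a: "a < length es" for a
  proof -
    obtain k l where kl: "es ! a = (k, l)" by force
    then have arc: "(k, l) \<in> parcs G" using a set nth_mem by metis
    then have arc': "(l, k) \<in> parcs G"
      using arcs_symmetric by blast
    have "(nb_matrix es *\<^sub>v v) $ a = (\<Sum>b<length es. nb_entry (es ! a) (es ! b) * x (es ! b))"
      using a by (simp add: nb_matrix_def v_def scalar_prod_def atLeast0LessThan)
    also have "\<dots> = (\<Sum>e\<in>parcs G. nb_entry (k, l) e * x e)"
      unfolding kl by (rule over_arcs)
    also have "\<dots> = inflow G x k - x (l, k)"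
      unfolding inflow_def by (rule nb_row[OF arc']) (rule pair_finite_arcs)
    also have "\<dots> = z * x (k, l)"
      using zero[OF arc] by (simp add: defect_def algebra_simps)
    finally show ?thesis by (simp add: kl)
  qed
  have "v \<noteq> 0\<^sub>v (length es)"
  proof -
    obtain a where "a < length es" "es ! a = e0"
      using nz(1) set by (metis in_set_conv_nth)
    then have "v $ a \<noteq> 0" using nz(2) by (simp add: v_def)
    then show ?thesis using \<open>a < length es\<close> by auto
  qed
  then have "eigenvector (nb_matrix es) v z"
    using row by (auto simp: eigenvector_def nb_matrix_def v_def intro!: eq_vecI)
  moreover have "supported_on es v C"
    using supp by (simp add: supported_on_def v_def) (metis prod.collapse)
  ultimately show ?thesis by (auto simp: eigenvalue_def)
qed

section \<open>Cycles and their labellings\<close>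

text \<open>
  Chords are allowed, as in a collar with adjacent exceptional vertices; they are treated like
  arcs that lead out of the cycle.
\<close>

definition cycle_in :: "'a pair_pre_digraph \<Rightarrow> nat \<Rightarrow> (nat \<Rightarrow> 'a) \<Rightarrow> 'a set \<Rightarrow> bool" where
  "cycle_in G n f A \<longleftrightarrow> n \<ge> 3 \<and> bij_betw f {..<n} A \<and> (\<forall>i<n. (f i, f (Suc i mod n)) \<in> parcs G)"

lemma cycle_in_of_induced:
  assumes "n \<ge> 3" "induced_iso G n R f A" "\<And>i j. cycle_adj n i j \<Longrightarrow> R i j"
  shows "cycle_in G n f A"
proof -
  have "R i (Suc i mod n)" for i by (rule assms(3)) (simp add: cycle_adj_def)
  then show ?thesis using assms(1,2) by (simp add: cycle_in_def induced_iso_def)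
qed

text \<open>
  The wave on a cycle tolerates extra neighbours at its starting point, so the labelling is moved
  to start at the exceptional vertex.
\<close>

lemma cycle_in_rotate:
  assumes cyc: "cycle_in G n f A" and w: "w \<in> A"
  obtains g where "cycle_in G n g A" "g 0 = w"
proof -
  have n: "n \<ge> 3" and bij: "bij_betw f {..<n} A"
    and arcs: "\<And>i. i < n \<Longrightarrow> (f i, f (Suc i mod n)) \<in> parcs G"
    using cyc by (auto simp: cycle_in_def)
  obtain k where k: "k < n" "f k = w"
    using bij w by (auto simp: bij_betw_def)
  define s where "s = (\<lambda>i. (i + k) mod n)"
  have "inj_on s {..<n}"
  proof (rule inj_onI)
    fix i j assume "i \<in> {..<n}" "j \<in> {..<n}" "s i = s j"
    moreover have "s i = (if i + k < n then i + k else i + k - n)" if "i < n" for i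
      using that k(1) by (simp add: s_def mod_if)
    ultimately show "i = j" by (auto split: if_splits)
  qed
  moreover have "s ` {..<n} \<subseteq> {..<n}" using n by (auto simp: s_def)
  ultimately have "bij_betw s {..<n} {..<n}"
    by (simp add: bij_betw_def endo_inj_surj)
  then have "bij_betw (f \<circ> s) {..<n} A" using bij by (rule bij_betw_trans)
  moreover have "(f (s i), f (s (Suc i mod n))) \<in> parcs G" for i
  proof -
    have "s (Suc i mod n) = Suc (s i) mod n"
      by (simp add: s_def mod_simps)
    then show ?thesis using arcs[of "s i"] n by (simp add: s_def)
  qed
  ultimately have "cycle_in G n (f \<circ> s) A" using n by (simp add: cycle_in_def)
  moreover have "(f \<circ> s) 0 = w" using k by (simp add: s_def)
  ultimately show ?thesis using that by blast
qed

section \<open>The two opposite waves on a cycle\<close>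

text \<open>
  The relative sign and the shift of the second exponent are forced by the start: the inflow at
  \<open>f 0\<close> is the sum of the values on the last arc of the cycle and on the reverse of its first arc,
  and it must vanish when \<open>z\<^sup>n = 1\<close> and \<open>f 0\<close> has neighbours outside the cycle.
\<close>

definition cycle_vec :: "nat \<Rightarrow> (nat \<Rightarrow> 'a) \<Rightarrow> complex \<Rightarrow> 'a \<times> 'a \<Rightarrow> complex" where
  "cycle_vec n f z e =
     (\<Sum>i<n. of_bool (e = (f i, f (Suc i mod n))) * inverse z ^ i
           - of_bool (e = (f (Suc i mod n), f i)) * z ^ Suc i)"

definition cyc_pred :: "nat \<Rightarrow> nat \<Rightarrow> nat" where
  "cyc_pred n m = (if m = 0 then n - 1 else m - 1)"

lemma cyc_pred_less: "m < n \<Longrightarrow> cyc_pred n m < n"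
  by (auto simp: cyc_pred_def)

lemma Suc_mod_eq_iff: "m < n \<Longrightarrow> i < n \<Longrightarrow> m = Suc i mod n \<longleftrightarrow> i = cyc_pred n m"
  by (cases "Suc i = n") (auto simp: cyc_pred_def)

lemma Suc_mod_neq_cyc_pred: "n \<ge> 3 \<Longrightarrow> m < n \<Longrightarrow> Suc m mod n \<noteq> cyc_pred n m"
  by (cases "Suc m = n") (auto simp: cyc_pred_def)

lemma cycle_vec_outside:
  assumes cyc: "cycle_in G n f A" and "k \<notin> A \<or> l \<notin> A"
  shows "cycle_vec n f z (k, l) = 0"
proof -
  have off: "(k, l) \<noteq> (f i, f (Suc i mod n)) \<and> (k, l) \<noteq> (f (Suc i mod n), f i)" if "i < n" for i
  proof -
    have "Suc i mod n < n" using that by simp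
    then have "f i \<in> A" "f (Suc i mod n) \<in> A"
      using cyc that unfolding cycle_in_def by (metis bij_betwE lessThan_iff)+
    then show ?thesis using assms(2) by blast
  qed
  show ?thesis
    unfolding cycle_vec_def
  proof (intro sum.neutral ballI)
    fix i assume "i \<in> {..<n}"
    then have "(k, l) \<noteq> (f i, f (Suc i mod n))" "(k, l) \<noteq> (f (Suc i mod n), f i)"
      using off by blast+
    then show "of_bool ((k, l) = (f i, f (Suc i mod n))) * inverse z ^ i
        - of_bool ((k, l) = (f (Suc i mod n), f i)) * z ^ Suc i = 0"
      by (simp only: of_bool_eq mult_zero_left diff_self)
  qed
qed

lemma cycle_vec_vertex:
  assumes cyc: "cycle_in G n f A" and m: "m < n"
  shows cycle_vec_out: "cycle_vec n f z (f m, l)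
        = of_bool (l = f (Suc m mod n)) * inverse z ^ m
        - of_bool (l = f (cyc_pred n m)) * z ^ Suc (cyc_pred n m)"
    and cycle_vec_in: "cycle_vec n f z (l, f m)
        = of_bool (l = f (cyc_pred n m)) * inverse z ^ cyc_pred n m
        - of_bool (l = f (Suc m mod n)) * z ^ Suc m"
proof -
  have inj: "inj_on f {..<n}" using cyc by (simp add: cycle_in_def bij_betw_def)
  have leaving: "f m = f i \<longleftrightarrow> i = m" if "i < n" for i
    using inj_on_eq_iff[OF inj, of m i] m that by auto
  have entering: "f m = f (Suc i mod n) \<longleftrightarrow> i = cyc_pred n m" if "i < n" for i
  proof -
    have "f m = f (Suc i mod n) \<longleftrightarrow> m = Suc i mod n"
      using m by (intro inj_on_eq_iff[OF inj]) auto
    then show ?thesis by (simp only: Suc_mod_eq_iff[OF m that])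
  qed
  have select: "(\<Sum>i<n. of_bool (P i) * a i - of_bool (Q i) * b i)
      = of_bool p * a j - of_bool q * b j'"
    if "j < n" "j' < n" "\<And>i. i < n \<Longrightarrow> P i \<longleftrightarrow> i = j \<and> p" "\<And>i. i < n \<Longrightarrow> Q i \<longleftrightarrow> i = j' \<and> q"
    for P Q p q j j' and a b :: "nat \<Rightarrow> complex"
  proof -
    have "(\<Sum>i<n. of_bool (P i) * a i) = (\<Sum>i<n. if i = j then of_bool p * a j else 0)"
      by (rule sum.cong) (auto simp: that(3))
    moreover have "(\<Sum>i<n. of_bool (Q i) * b i) = (\<Sum>i<n. if i = j' then of_bool q * b j' else 0)"
      by (rule sum.cong) (auto simp: that(4))
    ultimately show ?thesis using that(1,2) by (simp add: sum_subtractf)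
  qed
  show "cycle_vec n f z (f m, l)
        = of_bool (l = f (Suc m mod n)) * inverse z ^ m
        - of_bool (l = f (cyc_pred n m)) * z ^ Suc (cyc_pred n m)"
    unfolding cycle_vec_def
    by (rule select[OF m cyc_pred_less[OF m]]) (use leaving entering in auto)
  show "cycle_vec n f z (l, f m)
        = of_bool (l = f (cyc_pred n m)) * inverse z ^ cyc_pred n m
        - of_bool (l = f (Suc m mod n)) * z ^ Suc m"
    unfolding cycle_vec_def
    by (rule select[OF cyc_pred_less[OF m] m]) (use leaving entering in auto)
qed

lemma cycle_neighbours:
  assumes G: "pair_graph G" and cyc: "cycle_in G n f A" and m: "m < n"
  shows "(f m, f (Suc m mod n)) \<in> parcs G" "(f (Suc m mod n), f m) \<in> parcs G"
    and "(f m, f (cyc_pred n m)) \<in> parcs G" "(f (cyc_pred n m), f m) \<in> parcs G"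
    and "f (Suc m mod n) \<noteq> f (cyc_pred n m)"
proof -
  interpret pair_graph G by (rule G)
  have p: "cyc_pred n m < n" "Suc (cyc_pred n m) mod n = m"
    using Suc_mod_eq_iff[OF m cyc_pred_less[OF m]] cyc_pred_less[OF m] by auto
  show "(f m, f (Suc m mod n)) \<in> parcs G" "(f (cyc_pred n m), f m) \<in> parcs G"
    using cyc m p unfolding cycle_in_def by (blast, metis)
  then show "(f (Suc m mod n), f m) \<in> parcs G" "(f m, f (cyc_pred n m)) \<in> parcs G"
    using arcs_symmetric by blast+
  show "f (Suc m mod n) \<noteq> f (cyc_pred n m)"
    using cyc Suc_mod_neq_cyc_pred[OF _ m] p(1) m
    by (auto simp: cycle_in_def bij_betw_def inj_on_eq_iff)
qed

lemma inflow_cycle_vec_outside: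
  assumes "cycle_in G n f A" "k \<notin> A"
  shows "inflow G (cycle_vec n f z) k = 0"
  unfolding inflow_def
proof (intro sum.neutral ballI)
  fix e assume "e \<in> {e \<in> parcs G. snd e = k}"
  then have "e = (fst e, k)" by (simp add: prod_eq_iff)
  then show "cycle_vec n f z e = 0"
    using cycle_vec_outside[OF assms(1), of "fst e" k z] assms(2) by metis
qed

lemma inflow_cycle_vec:
  assumes G: "pair_graph G" and cyc: "cycle_in G n f A" and m: "m < n"
  shows "inflow G (cycle_vec n f z) (f m) = inverse z ^ cyc_pred n m - z ^ Suc m"
proof -
  interpret pair_graph G by (rule G)
  let ?S = "{e \<in> parcs G. snd e = f m}"
  let ?p = "(f (cyc_pred n m), f m)" and ?s = "(f (Suc m mod n), f m)"
  have "inflow G (cycle_vec n f z) (f m)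
      = (\<Sum>e\<in>?S. (if e = ?p then inverse z ^ cyc_pred n m else 0) - (if e = ?s then z ^ Suc m else 0))"
    unfolding inflow_def
  proof (rule sum.cong[OF refl])
    fix e assume "e \<in> ?S"
    then obtain l where e: "e = (l, f m)" by (cases e) auto
    show "cycle_vec n f z e
        = (if e = ?p then inverse z ^ cyc_pred n m else 0) - (if e = ?s then z ^ Suc m else 0)"
      unfolding e cycle_vec_in[OF cyc m] by simp
  qed
  also have "\<dots> = inverse z ^ cyc_pred n m - z ^ Suc m"
  proof -
    have "finite ?S" "?p \<in> ?S" "?s \<in> ?S"
      using cycle_neighbours(2,4)[OF G cyc m] pair_finite_arcs by auto
    then show ?thesis by (simp only: sum_subtractf sum.delta if_True)
  qed
  finally show ?thesis .
qed

lemma degree_two_neighbours: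
  assumes G: "pair_graph G" and deg: "out_degree G k = 2"
    and "(k, a) \<in> parcs G" "(k, b) \<in> parcs G" "a \<noteq> b" "(k, l) \<in> parcs G"
  shows "l = a \<or> l = b"
proof -
  interpret pair_graph G by (rule G)
  have "card (out_arcs G k) = 2" using deg by (simp add: out_degree_def)
  then obtain e e' where "out_arcs G k = {e, e'}" by (auto simp: card_2_iff)
  moreover have "(k, a) \<in> out_arcs G k" "(k, b) \<in> out_arcs G k" "(k, l) \<in> out_arcs G k"
    using assms by (auto simp: out_arcs_def)
  ultimately show ?thesis using \<open>a \<noteq> b\<close> by auto
qed

text \<open>
  Only \<open>z\<^sup>2\<^sup>n = 1\<close>, that is \<open>z\<^sup>n = 1\<close> or \<open>z\<^sup>n = -1\<close>, is assumed, so that the lemma serves the two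
  halves of a bracelet as well. In the second case the forward wave changes its sign on its way
  around the cycle. This changes the inflow at \<open>f 0\<close>, but neither the inflow elsewhere nor the left
  side of the equation: the latter is still \<open>0\<close> on all arcs leaving \<open>f 0\<close>, as \<open>z\<^sup>-\<^sup>n = z\<^sup>n\<close>.
\<close>

lemma defect_cycle_vec:
  assumes G: "pair_graph G" and cyc: "cycle_in G n f A"
    and z: "z ^ (2 * n) = 1"
    and exc: "\<And>m. 0 < m \<Longrightarrow> m < n \<Longrightarrow> z ^ (2 * m) = 1 \<or> out_degree G (f m) = 2"
    and arc: "(k, l) \<in> parcs G"
  shows "defect G z (cycle_vec n f z) k l = (if k = f 0 then z * (1 - z ^ n) else 0)"
proof (cases "k \<in> A")
  case False
  moreover have "f 0 \<in> A" using cyc by (auto simp: cycle_in_def bij_betw_def)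
  ultimately show ?thesis
    using cyc by (auto simp: defect_def inflow_cycle_vec_outside[OF cyc] cycle_vec_outside[OF cyc])
next
  case True
  then obtain m where m: "m < n" and k: "k = f m"
    using cyc by (auto simp: cycle_in_def bij_betw_def)
  have n: "n \<ge> 3" and inj: "inj_on f {..<n}"
    using cyc by (auto simp: cycle_in_def bij_betw_def)
  have z0: "z \<noteq> 0" using z n by (auto simp: power_0_left)
  have inv: "inverse z ^ q = z ^ q" if "z ^ (2 * q) = 1" for q
  proof -
    have "z ^ q * z ^ q = 1" using that by (simp only: mult_2 power_add)
    then show ?thesis by (simp only: power_inverse inverse_unique)
  qed
  let ?p = "cyc_pred n m"
  note nb = cycle_neighbours[OF G cyc m]
  \<comment> \<open>The common value of the left side on the two cycle arcs that leave \<open>f m\<close>.\<close>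
  define P where "P = z * inverse z ^ m - z ^ Suc m"
  have shift: "z * inverse z ^ Suc q = inverse z ^ q" for q
    using z0 by (simp add: mult.assoc[symmetric])
  \<comment> \<open>The arc back to the predecessor gives the same value; at \<open>m = 0\<close> both vanish by \<open>inv\<close>.\<close>
  have P_pred: "inverse z ^ ?p - z * z ^ Suc ?p = P"
  proof (cases "m = 0")
    case True
    then have "Suc ?p = n" using n by (simp add: cyc_pred_def)
    then have "inverse z ^ ?p = z * z ^ n" using shift[of ?p] inv[OF z] by simp
    then show ?thesis using True \<open>Suc ?p = n\<close> by (simp add: P_def)
  next
    case False
    then obtain j where "m = Suc j" by (cases m) auto
    then show ?thesis using z0 by (simp add: P_def cyc_pred_def)
  qed
  have out: "z * cycle_vec n f z (k, l) + cycle_vec n f z (l, k)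
      = (if l = f (Suc m mod n) \<or> l = f ?p then P else 0)"
  proof -
    consider "l = f (Suc m mod n)" "l \<noteq> f ?p" | "l = f ?p" "l \<noteq> f (Suc m mod n)"
      | "l \<noteq> f (Suc m mod n)" "l \<noteq> f ?p"
      using nb(5) by metis
    then show ?thesis
      unfolding k cycle_vec_out[OF cyc m] cycle_vec_in[OF cyc m]
      by cases (simp_all add: P_def P_pred[unfolded P_def power_Suc])
  qed
  have inflow: "inflow G (cycle_vec n f z) k = inverse z ^ ?p - z ^ Suc m"
    unfolding k by (rule inflow_cycle_vec[OF G cyc m])
  show ?thesis
  proof (cases "m = 0")
    case True
    then have "Suc ?p = n" using n by (simp add: cyc_pred_def)
    then have "inverse z ^ ?p = z * z ^ n" using shift[of ?p] inv[OF z] by simp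
    then show ?thesis
      using True out inflow k by (simp add: defect_def P_def algebra_simps)
  next
    case False
    then have "k \<noteq> f 0" using k inj m n by (auto simp: inj_on_eq_iff)
    obtain j where j: "m = Suc j" using False by (cases m) auto
    then have "inflow G (cycle_vec n f z) k = P"
      using inflow z0 by (simp add: P_def cyc_pred_def)
    moreover have "(if l = f (Suc m mod n) \<or> l = f ?p then P else 0) = P"
    proof -
      \<comment> \<open>Either all arcs leaving \<open>f m\<close> lie on the cycle, or the required value is \<open>0\<close> anyway.\<close>
      have "P = 0" if "z ^ (2 * m) = 1"
        using inv[OF that] by (simp add: P_def)
      moreover have "l = f (Suc m mod n) \<or> l = f ?p" if "out_degree G (f m) = 2"
        using degree_two_neighbours[OF G that nb(1,3,5)] arc k by blast
      ultimately show ?thesis using exc[of m] False m by auto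
    qed
    ultimately show ?thesis using out \<open>k \<noteq> f 0\<close> by (simp add: defect_def)
  qed
qed

lemma first_arc:
  assumes "cycle_in G n f A"
  shows "(f 0, f 1) \<in> parcs G"
proof -
  have "0 < n" "Suc 0 mod n = 1" using assms by (auto simp: cycle_in_def)
  then show ?thesis using assms unfolding cycle_in_def by metis
qed

lemma cycle_vec_start:
  assumes "cycle_in G n f A"
  shows "cycle_vec n f z (f 0, f 1) = 1"
proof -
  have n: "n \<ge> 3" and inj: "inj_on f {..<n}"
    using assms by (auto simp: cycle_in_def bij_betw_def)
  have "f 1 \<noteq> f (n - 1)" using inj n by (auto simp: inj_on_eq_iff)
  then show ?thesis
    using cycle_vec_out[OF assms, of 0 z "f 1"] n by (simp add: cyc_pred_def)
qed

section \<open>Eigenvectors on one cycle and on two cycles\<close>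

lemma single_cycle:
  assumes G: "pair_graph G" and es: "enumerates_arcs es G"
    and cyc: "cycle_in G n f C" and z: "z ^ n = 1"
    and exc: "\<And>m. 0 < m \<Longrightarrow> m < n \<Longrightarrow> z ^ (2 * m) = 1 \<or> out_degree G (f m) = 2"
  shows "eigenvalue (nb_matrix es) z \<and>
    (\<exists>v. eigenvector (nb_matrix es) v z \<and> supported_on es v C)"
proof (rule eigenvector_of_zero_defect[OF G es])
  have z2: "z ^ (2 * n) = 1" using z by (simp add: mult_2 power_add)
  show "defect G z (cycle_vec n f z) k l = 0" if "(k, l) \<in> parcs G" for k l
    using defect_cycle_vec[OF G cyc z2 exc that] z by simp
  show "cycle_vec n f z (k, l) = 0" if "\<not> (k \<in> C \<and> l \<in> C)" for k l
    using cycle_vec_outside[OF cyc] that by blast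
  show "cycle_vec n f z (f 0, f 1) \<noteq> 0" using cycle_vec_start[OF cyc, of z] by simp
  show "(f 0, f 1) \<in> parcs G"
    by (rule first_arc[OF cyc])
qed

text \<open>
  If \<open>z\<^sup>n = -1\<close>, each wave alone fails at the common vertex \<open>w\<close> by the same amount on every arc
  leaving \<open>w\<close>, including the arcs of the other cycle and those out of the figure eight; the
  difference cancels this in all these places at once.
\<close>

lemma two_cycles:
  assumes G: "pair_graph G" and es: "enumerates_arcs es G"
    and f: "cycle_in G n f A" and g: "cycle_in G n g A'"
    and inter: "A \<inter> A' = {w}" and w: "f 0 = w" "g 0 = w"
    and deg: "\<And>v. v \<in> A \<union> A' - {w} \<Longrightarrow> out_degree G v = 2"
    and z: "z ^ (2 * n) = 1"
  shows "eigenvalue (nb_matrix es) z \<and>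
    (\<exists>v. eigenvector (nb_matrix es) v z \<and> supported_on es v (A \<union> A'))"
proof (rule eigenvector_of_zero_defect[OF G es])
  let ?x = "\<lambda>e. cycle_vec n f z e - cycle_vec n g z e"
  have deg_cycle: "out_degree G (h m) = 2"
    if "cycle_in G n h B" "B \<subseteq> A \<union> A'" "h 0 = w" "0 < m" "m < n" for h B m
  proof -
    have "h m \<in> B" "h m \<noteq> h 0"
      using that by (auto simp: cycle_in_def bij_betw_def inj_on_eq_iff)
    then show ?thesis using that deg by auto
  qed
  show "defect G z ?x k l = 0" if arc: "(k, l) \<in> parcs G" for k l
  proof -
    have "defect G z ?x k l = defect G z (cycle_vec n f z) k l - defect G z (cycle_vec n g z) k l"
      by (simp add: defect_def inflow_def sum_subtractf algebra_simps)
    also have "\<dots> = 0"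
      using defect_cycle_vec[OF G f z _ arc] defect_cycle_vec[OF G g z _ arc]
        deg_cycle[OF f] deg_cycle[OF g] w by simp
    finally show ?thesis .
  qed
  show "?x (k, l) = 0" if "\<not> (k \<in> A \<union> A' \<and> l \<in> A \<union> A')" for k l
    using cycle_vec_outside[OF f, of k l] cycle_vec_outside[OF g, of k l] that by auto
  have n: "n \<ge> 3" using f by (simp add: cycle_in_def)
  have "f 1 \<in> A" "f 1 \<noteq> f 0"
    using f n by (auto simp: cycle_in_def bij_betw_def inj_on_eq_iff)
  \<comment> \<open>The first arc of one cycle leaves the other cycle, so no cancellation happens there.\<close>
  then have "f 1 \<notin> A'" using inter w by auto
  then show "?x (f 0, f 1) \<noteq> 0"
    using cycle_vec_start[OF f] cycle_vec_outside[OF g, of "f 0" "f 1"] by simp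
  show "(f 0, f 1) \<in> parcs G"
    by (rule first_arc[OF f])
qed

theorem mainTheorem1:
  fixes G :: "'a pair_pre_digraph"
    and es :: "('a \<times> 'a) list"
    and C :: "'a set"
    and r :: nat
    and z :: complex
  assumes "pair_graph G"
    and "Digraph_Component.connected (with_proj G)"
    and "card (pverts G) \<ge> 2"
    and "enumerates_arcs es G"
    and "collar G C r \<or> pendant G C r \<or> bracelet G C r"
    and "z ^ r = 1"
  shows "eigenvalue (nb_matrix es) z \<and>
    (\<exists>v. eigenvector (nb_matrix es) v z \<and> supported_on es v C)"
proof -
  note G = assms(1) and es = assms(4)
  from assms(5) consider "collar G C r" | "pendant G C r" | "bracelet G C r" by blast
  then show ?thesis
  proof cases
    case 1
    then obtain f where r: "even r" "r \<ge> 3"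
      and iso: "induced_iso G r (cycle_adj r) f C \<or> induced_iso G r (chorded_cycle_adj r) f C"
      and deg: "\<And>v. v \<in> C - {f 0, f (r div 2)} \<Longrightarrow> out_degree G v = 2"
      by (auto simp: collar_def)
    have cyc: "cycle_in G r f C"
      using iso cycle_in_of_induced[OF r(2)] by (auto simp: chorded_cycle_adj_def)
    then have "f m \<in> C - {f 0, f (r div 2)}" if "0 < m" "m < r" "m \<noteq> r div 2" for m
      using that by (auto simp: cycle_in_def bij_betw_def inj_on_eq_iff)
    \<comment> \<open>At the antipode \<open>m = r div 2\<close> the exponent \<open>2 * m\<close> is \<open>r\<close> itself.\<close>
    then have "z ^ (2 * m) = 1 \<or> out_degree G (f m) = 2" if "0 < m" "m < r" for m
      using that deg r(1) assms(6) by (cases "m = r div 2") auto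
    then show ?thesis by (rule single_cycle[OF G es cyc assms(6)])
  next
    case 2
    then obtain f w where "cycle_in G r f C" and w: "w \<in> C"
      and deg: "\<And>v. v \<in> C - {w} \<Longrightarrow> out_degree G v = 2"
      by (auto simp: pendant_def induces_cycle_def intro: cycle_in_of_induced)
    then obtain g where cyc: "cycle_in G r g C" and "g 0 = w"
      using cycle_in_rotate by metis
    then have "g m \<in> C - {w}" if "0 < m" "m < r" for m
      using that by (auto simp: cycle_in_def bij_betw_def inj_on_eq_iff)
    then show ?thesis using deg by (intro single_cycle[OF G es cyc assms(6)]) blast
  next
    case 3
    then obtain A A' w f g where C: "C = A \<union> A'" and inter: "A \<inter> A' = {w}" and "even r"
      and "cycle_in G (r div 2) f A" "cycle_in G (r div 2) g A'"
      and deg: "\<And>v. v \<in> C - {w} \<Longrightarrow> out_degree G v = 2"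
      unfolding bracelet_def induces_cycle_def by (metis cycle_in_of_induced)
    moreover have "w \<in> A" "w \<in> A'" using inter by auto
    ultimately obtain f' g' where f': "cycle_in G (r div 2) f' A" "f' 0 = w"
      and g': "cycle_in G (r div 2) g' A'" "g' 0 = w"
      using cycle_in_rotate by metis
    have "z ^ (2 * (r div 2)) = 1" using \<open>even r\<close> assms(6) by simp
    with deg show ?thesis
      unfolding C by (intro two_cycles[OF G es f'(1) g'(1) inter f'(2) g'(2)])
  qed
qed

end
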